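(* Let $f:\mathbb{R}^n\to\mathbb{R}$ be differentiable, convex and $L$-smooth. Let $h_k\in\left(0,\frac1{\sqrt L}\right]$ for $k\ge0$ and let $(t_k)_{k\ge0}$ be a divergent sequence of positive numbers. Let $w_k=\frac{2h_k}{t_k}$, and let $(x_k),(v_k),(y_k)$ satisfy, for all $k\ge0$, $$y_k=(1-w_k)x_k+w_kv_k,$$ $$x_{k+1}-x_k=\frac{2h_k}{t_k}(v_k-x_k)-\frac{h_k}{\sqrt L}\nabla f(y_k),\qquad v_{k+1}-v_k=-\frac{h_kt_k}{2}\nabla f(y_k).$$ Then this scheme can be rewritten as: for all $k\ge0$, $$x_{k+1}=y_k-\frac{\alpha_k}{L}\nabla f(y_k),\qquad y_{k+1}=x_{k+1}+\beta_k(x_{k+1}-x_k)+\gamma_k(y_k-x_k),$$ where $$\alpha_k=\sqrt L\,h_k,\qquad \beta_k=\frac{h_{k+1}}{t_{k+1}}\left(t_k\sqrt L-2\right),\qquad \gamma_k=\frac{t_k}{t_{k+1}}\frac{h_{k+1}}{h_k}\left(1-\sqrt L\,h_k\right).$$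
   Context: $f$ is $L$-smooth if $f(y)-f(x)+\nabla f(x)\cdot(x-y)\le \frac L2|x-y|^2$ for all $x,y$. *)

theory Defs
  imports "HOL-Analysis.Analysis"
begin

definition grad :: "('a::euclidean_space \<Rightarrow> real) \<Rightarrow> 'a \<Rightarrow> 'a"
  where "grad f x = (THE d. GDERIV f x :> d)"

lemma GDERIV_grad:
  fixes f :: "'a::euclidean_space \<Rightarrow> real"
  assumes "f differentiable (at x)"
  shows "GDERIV f x :> grad f x"
proof -
  obtain D where D: "(f has_derivative D) (at x)"
    using assms unfolding differentiable_def by blast
  have "D = (\<lambda>h. h \<bullet> adjoint D 1)"
    using adjoint_works[OF has_derivative_linear[OF D], of _ "1::real"] by auto
  with D have "GDERIV f x :> adjoint D 1"
    by (simp add: gderiv_def)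
  moreover have "d = d'" if "GDERIV f x :> d" "GDERIV f x :> d'" for d d'
    using that has_derivative_unique unfolding gderiv_def
    by (metis inner_commute vector_eq_ldot)
  ultimately show ?thesis
    unfolding grad_def by (metis theI)
qed

definition L_smooth :: "real \<Rightarrow> ('a::euclidean_space \<Rightarrow> real) \<Rightarrow> bool"
  where "L_smooth L f \<longleftrightarrow>
    (\<forall>x y. f y - f x + grad f x \<bullet> (x - y) \<le> L / 2 * (norm (x - y))\<^sup>2)"

end

theory Submission
  imports Defs
begin

text \<open>
  The definition of \<open>y\<^sub>k\<close> gives \<open>v\<^sub>k - x\<^sub>k = (t\<^sub>k / (2 h\<^sub>k)) (y\<^sub>k - x\<^sub>k)\<close>, and the gradient step
  gives \<open>h\<^sub>k grad f (y\<^sub>k) = sqrt L (y\<^sub>k - x\<^sub>k\<^sub>+\<^sub>1)\<close>. Eliminating \<open>v\<close> and the gradient from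
  \<open>y\<^sub>k\<^sub>+\<^sub>1 - x\<^sub>k\<^sub>+\<^sub>1 = w\<^sub>k\<^sub>+\<^sub>1 (v\<^sub>k\<^sub>+\<^sub>1 - x\<^sub>k\<^sub>+\<^sub>1)\<close> leaves a combination of \<open>x\<^sub>k\<^sub>+\<^sub>1 - x\<^sub>k\<close> and
  \<open>y\<^sub>k - x\<^sub>k\<close> only.
\<close>

theorem proposition4p2:
  fixes f :: "real ^ 'n \<Rightarrow> real"
    and L :: real
    and h t w \<alpha> \<beta> \<gamma> :: "nat \<Rightarrow> real"
    and x v y :: "nat \<Rightarrow> real ^ 'n"
  assumes "L > 0"
    and "\<And>z. f differentiable (at z)"
    and "convex_on UNIV f"
    and "L_smooth L f"
    and "\<And>k. h k \<in> {0 <.. 1 / sqrt L}"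
    and "\<And>k. t k > 0"
    and "\<not> convergent t"
    and "\<And>k. w k = 2 * h k / t k"
    and "\<And>k. y k = (1 - w k) *\<^sub>R x k + w k *\<^sub>R v k"
    and "\<And>k. x (Suc k) - x k
            = (2 * h k / t k) *\<^sub>R (v k - x k) - (h k / sqrt L) *\<^sub>R grad f (y k)"
    and "\<And>k. v (Suc k) - v k = - ((h k * t k / 2) *\<^sub>R grad f (y k))"
    and "\<And>k. \<alpha> k = sqrt L * h k"
    and "\<And>k. \<beta> k = h (Suc k) / t (Suc k) * (t k * sqrt L - 2)"
    and "\<And>k. \<gamma> k = t k / t (Suc k) * (h (Suc k) / h k) * (1 - sqrt L * h k)"
  shows "\<forall>k. x (Suc k) = y k - (\<alpha> k / L) *\<^sub>R grad f (y k) \<and>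
             y (Suc k) = x (Suc k) + \<beta> k *\<^sub>R (x (Suc k) - x k) + \<gamma> k *\<^sub>R (y k - x k)"
proof
  fix k
  let ?s = "sqrt L" and ?g = "grad f (y k)"
  have pos: "h k > 0" "t k > 0" "t (Suc k) > 0" "?s > 0"
    using assms(1,5,6) by auto
  have y_eq: "y j - x j = w j *\<^sub>R (v j - x j)" for j
    using assms(9)[of j] by (simp add: algebra_simps)
  have "\<alpha> k / L = h k / ?s"
    using assms(1,12) by (simp add: field_simps flip: power2_eq_square)
  \<comment> \<open>By \<open>y_eq\<close>, the \<open>v\<close>-term of the \<open>x\<close>-update
    is exactly \<open>y k - x k\<close>.\<close>
  moreover have "x (Suc k) - x k = (y k - x k) - (h k / ?s) *\<^sub>R ?g"
    by (simp only: assms(8,10) y_eq)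
  ultimately have x_step: "x (Suc k) = y k - (\<alpha> k / L) *\<^sub>R ?g"
    and g_eq: "y k - x (Suc k) = (h k / ?s) *\<^sub>R ?g"
    by (simp_all add: algebra_simps)
  have v_eq: "v k - x k = (t k / (2 * h k)) *\<^sub>R (y k - x k)"
    using y_eq[of k] assms(8)[of k] pos by simp
  have "(h k * t k / 2) *\<^sub>R ?g = (t k * ?s / 2) *\<^sub>R (y k - x (Suc k))"
    using pos by (simp add: g_eq)
  then have "v (Suc k) - v k = - ((t k * ?s / 2) *\<^sub>R (y k - x (Suc k)))"
    using assms(11)[of k] by simp
  \<comment> \<open>Telescope through \<open>v k\<close> and \<open>x k\<close>; splitting
    \<open>y k - x (Suc k)\<close> at \<open>x k\<close> as well prepares for the two target
    differences.\<close>
  then have "v (Suc k) - x (Suc k) =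
      (v k - x k) - (x (Suc k) - x k)
        - (t k * ?s / 2) *\<^sub>R ((y k - x k) - (x (Suc k) - x k))"
    by (simp add: algebra_simps)
  also have "\<dots> = (t k * ?s / 2 - 1) *\<^sub>R (x (Suc k) - x k)
      + (t k / (2 * h k) - t k * ?s / 2) *\<^sub>R (y k - x k)"
    \<comment> \<open>The instantiation splits only the outer difference; \<open>y k - x k\<close>
      and \<open>x (Suc k) - x k\<close> stay whole.\<close>
    unfolding v_eq scaleR_left_diff_distrib scaleR_right_diff_distrib[of _ "y k - x k"] by simp
  finally have "y (Suc k) - x (Suc k) =
      (w (Suc k) * (t k * ?s / 2 - 1)) *\<^sub>R (x (Suc k) - x k)
      + (w (Suc k) * (t k / (2 * h k) - t k * ?s / 2)) *\<^sub>R (y k - x k)"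
    by (simp add: y_eq[of "Suc k"] scaleR_add_right)
  moreover have "w (Suc k) * (t k * ?s / 2 - 1) = \<beta> k"
    using pos by (simp add: assms(8,13) field_simps)
  \<comment> \<open>The bracket factors as
    \<open>t k / (2 * h k) * (1 - sqrt L * h k)\<close>.\<close>
  moreover have "w (Suc k) * (t k / (2 * h k) - t k * ?s / 2) = \<gamma> k"
    using pos by (simp add: assms(8,14) field_simps)
  ultimately have "y (Suc k) = x (Suc k) + \<beta> k *\<^sub>R (x (Suc k) - x k) + \<gamma> k *\<^sub>R (y k - x k)"
    by (simp add: diff_eq_eq add.commute add.left_commute)
  with x_step show "x (Suc k) = y k - (\<alpha> k / L) *\<^sub>R ?g \<and>
      y (Suc k) = x (Suc k) + \<beta> k *\<^sub>R (x (Suc k) - x k) + \<gamma> k *\<^sub>R (y k - x k)" ..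
qed

end
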